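(* Let $A_1,A_2$ be two nonzero diagonal matrices in $\operatorname{End}(\mathbb C^m)$ such that $\operatorname{tr}(A_1)\neq0$ and $\operatorname{tr}(A_1^e)\operatorname{tr}(A_2)^e=\operatorname{tr}(A_1)^e\operatorname{tr}(A_2^e)$ for every $e=1,\dots,m$. Then there exists a constant $t\in\mathbb C^*$ such that $A_1$ is conjugate to $tA_2$. *)

theory Defs
  imports Complex_Main "Jordan_Normal_Form.Matrix"
begin

definition mat_trace :: "'a::comm_monoid_add mat \<Rightarrow> 'a" where
  "mat_trace A = (\<Sum>i<dim_row A. A $$ (i, i))"

end

theory Submission
  imports Defs
    "HOL-Computational_Algebra.Polynomial_FPS"
    "HOL-Combinatorics.Permutations"
begin

text \<open>
  The hypothesis is homogeneous of degree \<open>e\<close> in each matrix, so it says that, once both traces are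
  normalised to the same value, the two diagonals have the same power sums of exponents
  \<open>1, \<dots>, m\<close>. In characteristic 0, Newton's identities recover from these the elementary symmetric
  functions, hence the monic polynomial whose roots are the diagonal entries, hence the entries
  themselves up to order (\<open>mset_eq_if_power_sums_eq\<close>). Diagonal matrices whose diagonals are
  rearrangements of each other are conjugate by a permutation matrix
  (\<open>similar_diagonal_mat_if_diagonal_permuted\<close>).

  The normalising factor \<open>t = tr A\<^sub>1 / tr A\<^sub>2\<close> requires \<open>tr A\<^sub>2 \<noteq> 0\<close>. If \<open>tr A\<^sub>2\<close> vanished, then, as
  \<open>tr A\<^sub>1 \<noteq> 0\<close>, so would all power sums of the diagonal of \<open>A\<^sub>2\<close>; by the same recovery principle
  that diagonal would be zero, contradicting \<open>A\<^sub>2 \<noteq> 0\<close>.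
\<close>

section \<open>Power sums determine a finite multiset\<close>

text \<open>
  Newton's identities in generating-function form: the logarithmic derivative of
  \<open>1 - x X\<close> is \<open>-x / (1 - x X) = -(x + x\<^sup>2 X + x\<^sup>3 X\<^sup>2 + \<dots>)\<close>, and logarithmic derivatives
  of factors add up.
\<close>

lemma fps_deriv_prod_mset_linear_factors:
  fixes M :: "'a::field multiset"
  shows "fps_deriv (\<Prod>x\<in>#M. 1 - fps_const x * fps_X) =
    - ((\<Prod>x\<in>#M. 1 - fps_const x * fps_X) * Abs_fps (\<lambda>n. \<Sum>x\<in>#M. x ^ Suc n))"
proof (induction M)
  case empty
  show ?case by (simp add: fps_eq_iff)
next
  case (add x M)
  let ?l = "1 - fps_const x * fps_X :: 'a fps"
  let ?P = "\<Prod>x\<in>#M. 1 - fps_const x * fps_X :: 'a fps"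
  let ?S = "Abs_fps (\<lambda>n. \<Sum>x\<in>#M. x ^ Suc n)"
  let ?G = "Abs_fps (\<lambda>n. x ^ Suc n)"
  have geometric: "?l * ?G = fps_const x"
  proof (rule fps_ext)
    fix n
    show "fps_nth (?l * ?G) n = fps_nth (fps_const x) n"
      by (cases n) (simp_all add: left_diff_distrib mult.assoc)
  qed
  have "Abs_fps (\<lambda>n. \<Sum>y\<in>#add_mset x M. y ^ Suc n) = ?G + ?S"
    by (simp add: fps_eq_iff)
  moreover have "fps_deriv (?l * ?P) = - (?l * ?P * (?G + ?S))"
  proof -
    have "fps_deriv (?l * ?P) = - fps_const x * ?P + ?l * fps_deriv ?P"
      by simp
    also have "\<dots> = - (?l * ?G) * ?P + ?l * (- (?P * ?S))"
      using add.IH geometric by simp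
    also have "\<dots> = - (?l * ?P * (?G + ?S))"
      by (simp add: algebra_simps del: mult_minus_left)
    finally show ?thesis .
  qed
  ultimately show ?case by simp
qed

text \<open>
  Comparing coefficients in Newton's identity expresses \<open>n + 1\<close> times the coefficient of
  \<open>X ^ (n + 1)\<close> through earlier coefficients and the power sums of exponents up to \<open>n + 1\<close>.
  Characteristic 0 allows division by \<open>n + 1\<close>.
\<close>

lemma fps_nth_prod_mset_linear_factors_cong:
  fixes M N :: "'a::field_char_0 multiset"
  assumes "\<And>e. e \<in> {1..n} \<Longrightarrow> (\<Sum>x\<in>#M. x ^ e) = (\<Sum>x\<in>#N. x ^ e)"
  shows "fps_nth (\<Prod>x\<in>#M. 1 - fps_const x * fps_X) n =
    fps_nth (\<Prod>x\<in>#N. 1 - fps_const x * fps_X) n"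
  using assms
proof (induction n rule: less_induct)
  case (less n)
  let ?P = "\<lambda>M. \<Prod>x\<in>#M. 1 - fps_const (x::'a) * fps_X"
  show ?case
  proof (cases n)
    case 0
    have "fps_nth (?P M) 0 = 1" for M
      by (induction M) simp_all
    then show ?thesis using 0 by simp
  next
    case (Suc k)
    have newton: "of_nat (Suc k) * fps_nth (?P M) (Suc k) =
        - (\<Sum>i=0..k. fps_nth (?P M) i * (\<Sum>x\<in>#M. x ^ Suc (k - i)))" for M
    proof -
      have "of_nat (Suc k) * fps_nth (?P M) (Suc k) = fps_nth (fps_deriv (?P M)) k"
        by simp
      also have "\<dots> = - (\<Sum>i=0..k. fps_nth (?P M) i * (\<Sum>x\<in>#M. x ^ Suc (k - i)))"
        by (simp only: fps_deriv_prod_mset_linear_factors fps_neg_nth fps_mult_nth fps_nth_Abs_fps)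
      finally show ?thesis .
    qed
    have "(\<Sum>i=0..k. fps_nth (?P M) i * (\<Sum>x\<in>#M. x ^ Suc (k - i))) =
        (\<Sum>i=0..k. fps_nth (?P N) i * (\<Sum>x\<in>#N. x ^ Suc (k - i)))"
    proof (rule sum.cong[OF refl])
      fix i assume "i \<in> {0..k}"
      then have "fps_nth (?P M) i = fps_nth (?P N) i"
        using Suc by (intro less.IH less.prems) auto
      moreover have "(\<Sum>x\<in>#M. x ^ Suc (k - i)) = (\<Sum>x\<in>#N. x ^ Suc (k - i))"
        using Suc by (intro less.prems) auto
      ultimately show "fps_nth (?P M) i * (\<Sum>x\<in>#M. x ^ Suc (k - i)) =
          fps_nth (?P N) i * (\<Sum>x\<in>#N. x ^ Suc (k - i))" by simp
    qed
    then have "of_nat (Suc k) * fps_nth (?P M) (Suc k) = of_nat (Suc k) * fps_nth (?P N) (Suc k)"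
      by (simp only: newton)
    then show ?thesis
      unfolding Suc by (simp del: of_nat_Suc)
  qed
qed

lemma degree_prod_mset_linear_factors:
  "degree (\<Prod>x\<in>#M. [:- x, 1:]) = size (M :: 'a::field multiset)"
proof (induction M)
  case (add x M)
  have "(\<Prod>x\<in>#M. [:- x, 1:]) \<noteq> 0" by auto
  then show ?case using add by (simp add: degree_mult_eq del: mult_pCons_left)
qed simp

lemma fps_of_reflect_poly_prod_mset_linear_factors:
  fixes M :: "'a::field multiset"
  shows "fps_of_poly (reflect_poly (\<Prod>x\<in>#M. [:- x, 1:])) =
    (\<Prod>x\<in>#M. 1 - fps_const x * fps_X)"
proof (induction M)
  case (add x M)
  have "reflect_poly [:- x, 1:] = [:1, - x:]"
    by (simp add: reflect_poly_def)
  then have "fps_of_poly (reflect_poly [:- x, 1:]) = 1 - fps_const x * fps_X"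
    by (simp only: fps_of_poly_linear') (simp flip: fps_const_neg)
  then show ?case
    using add by (simp add: reflect_poly_mult fps_of_poly_mult del: mult_pCons_left)
qed simp

lemma proots_prod_mset_linear_factors:
  "proots (\<Prod>x\<in>#M. [:- x, 1:]) = (M :: 'a::field multiset)"
proof (induction M)
  case (add x M)
  have "(\<Prod>x\<in>#M. [:- x, 1:]) \<noteq> 0" by auto
  then show ?case using add by (simp add: proots_mult del: mult_pCons_left)
qed simp

text \<open>
  The series of the previous lemmas is the reversal of the monic polynomial \<open>\<Prod>x\<in>#M. (X - x)\<close>.
  The reversal loses the multiplicity of the root 0, which is why both multisets must have the
  same size. That size bounds the degree, so exponents up to it suffice.
\<close>

lemma mset_eq_if_power_sums_eq:
  fixes M N :: "'a::field_char_0 multiset"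
  assumes size: "size M = size N"
    and power_sums: "\<And>e. e \<in> {1..size M} \<Longrightarrow> (\<Sum>x\<in>#M. x ^ e) = (\<Sum>x\<in>#N. x ^ e)"
  shows "M = N"
proof -
  let ?C = "\<lambda>M. \<Prod>x\<in>#M. [:- (x::'a), 1:]"
  have coeff_reversed: "coeff (?C M) k =
      fps_nth (\<Prod>x\<in>#M. 1 - fps_const x * fps_X) (size M - k)" if "k \<le> size M" for M k
  proof -
    have "fps_nth (\<Prod>x\<in>#M. 1 - fps_const x * fps_X) (size M - k) =
        coeff (reflect_poly (?C M)) (size M - k)"
      by (simp flip: fps_of_reflect_poly_prod_mset_linear_factors)
    also have "\<dots> = coeff (?C M) k"
      using that by (simp add: coeff_reflect_poly degree_prod_mset_linear_factors)
    finally show ?thesis by simp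
  qed
  have "?C M = ?C N"
  proof (rule poly_eqI)
    fix k
    show "coeff (?C M) k = coeff (?C N) k"
    proof (cases "k \<le> size M")
      case True
      then have "fps_nth (\<Prod>x\<in>#M. 1 - fps_const x * fps_X) (size M - k) =
          fps_nth (\<Prod>x\<in>#N. 1 - fps_const x * fps_X) (size M - k)"
        by (intro fps_nth_prod_mset_linear_factors_cong power_sums) auto
      then show ?thesis using True size by (simp add: coeff_reversed)
    next
      case False
      then show ?thesis using size by (simp add: coeff_eq_0 degree_prod_mset_linear_factors)
    qed
  qed
  then have "proots (?C M) = proots (?C N)" by simp
  then show ?thesis by (simp only: proots_prod_mset_linear_factors)
qed

section \<open>Diagonal matrices\<close>

lemma diagonal_mat_pow_entry:
  fixes A :: "'a::comm_semiring_1 mat"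
  assumes A: "A \<in> carrier_mat n n" and diag: "diagonal_mat A" and "i < n" "j < n"
  shows "(A ^\<^sub>m e) $$ (i, j) = (if i = j then A $$ (i, i) ^ e else 0)"
  using \<open>j < n\<close>
proof (induction e arbitrary: j)
  case 0
  then show ?case using A \<open>i < n\<close> by simp
next
  case (Suc e)
  have "(A ^\<^sub>m Suc e) $$ (i, j) = (\<Sum>k = 0..<n. (A ^\<^sub>m e) $$ (i, k) * A $$ (k, j))"
    using A \<open>i < n\<close> Suc.prems by (auto simp: scalar_prod_def)
  also have "\<dots> = (\<Sum>k = 0..<n. if k = i then A $$ (i, i) ^ e * A $$ (i, j) else 0)"
    using Suc.IH by (intro sum.cong) auto
  also have "\<dots> = A $$ (i, i) ^ e * A $$ (i, j)"
    using \<open>i < n\<close> by simp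
  also have "\<dots> = (if i = j then A $$ (i, i) ^ Suc e else 0)"
    using A diag \<open>i < n\<close> Suc.prems by (auto simp: diagonal_mat_def mult.commute)
  finally show ?case .
qed

lemma mat_trace_diagonal_mat_pow:
  fixes A :: "'a::comm_semiring_1 mat"
  assumes "A \<in> carrier_mat n n" and "diagonal_mat A"
  shows "mat_trace (A ^\<^sub>m e) = (\<Sum>i<n. A $$ (i, i) ^ e)"
  using assms diagonal_mat_pow_entry[OF assms] by (auto simp: mat_trace_def intro!: sum.cong)

definition permutation_mat :: "nat \<Rightarrow> (nat \<Rightarrow> nat) \<Rightarrow> 'a::semiring_1 mat" where
  "permutation_mat n p = mat n n (\<lambda>(i, j). if j = p i then 1 else 0)"

lemma permutation_mat_carrier [simp]: "permutation_mat n p \<in> carrier_mat n n"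
  by (simp add: permutation_mat_def)

lemma permutation_mat_mult_entry:
  assumes "p permutes {..<n}" and "B \<in> carrier_mat n n" and "i < n" "j < n"
  shows "(permutation_mat n p * B) $$ (i, j) = B $$ (p i, j)"
proof -
  have "p i < n"
    using permutes_in_image[OF assms(1), of i] \<open>i < n\<close> by simp
  have "(permutation_mat n p * B) $$ (i, j) =
      (\<Sum>k = 0..<n. (if k = p i then 1 else 0) * B $$ (k, j))"
    using assms by (simp add: permutation_mat_def scalar_prod_def)
  also have "\<dots> = (\<Sum>k = 0..<n. if k = p i then B $$ (p i, j) else 0)"
    by (intro sum.cong) auto
  finally show ?thesis using \<open>p i < n\<close> by simp
qed

lemma mult_permutation_mat_inv_entry:
  assumes "p permutes {..<n}" and "B \<in> carrier_mat n n" and "i < n" "j < n"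
  shows "(B * permutation_mat n (inv_into UNIV p)) $$ (i, j) = B $$ (i, p j)"
proof -
  have "p j < n"
    using permutes_in_image[OF assms(1), of j] \<open>j < n\<close> by simp
  have "j = inv_into UNIV p k \<longleftrightarrow> k = p j" for k
    using permutes_inverses[OF assms(1)] by metis
  then have "(B * permutation_mat n (inv_into UNIV p)) $$ (i, j) =
      (\<Sum>k = 0..<n. B $$ (i, k) * (if k = p j then 1 else 0))"
    using assms by (simp add: permutation_mat_def scalar_prod_def)
  also have "\<dots> = (\<Sum>k = 0..<n. if k = p j then B $$ (i, p j) else 0)"
    by (intro sum.cong) auto
  finally show ?thesis using \<open>p j < n\<close> by simp
qed

lemma permutation_mat_mult_inv:
  assumes "p permutes {..<n}"
  shows "permutation_mat n p * permutation_mat n (inv_into UNIV p) = 1\<^sub>m n"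
proof (rule eq_matI)
  fix i j assume "i < dim_row (1\<^sub>m n)" "j < dim_col (1\<^sub>m n)"
  then have *: "i < n" "j < n" by simp_all
  have "p j < n"
    using permutes_in_image[OF assms, of j] * by simp
  have "(permutation_mat n p * permutation_mat n (inv_into UNIV p)) $$ (i, j) =
      permutation_mat n p $$ (i, p j)"
    using assms permutation_mat_carrier * by (rule mult_permutation_mat_inv_entry)
  also have "\<dots> = 1\<^sub>m n $$ (i, j)"
    using * \<open>p j < n\<close> permutes_inj[OF assms] by (auto simp: permutation_mat_def inj_eq)
  finally show "(permutation_mat n p * permutation_mat n (inv_into UNIV p)) $$ (i, j) =
      1\<^sub>m n $$ (i, j)" .
qed (simp_all add: permutation_mat_def)

text \<open>
  Conjugation by the permutation matrix of \<open>p\<close> replaces the entry at \<open>(i, j)\<close> by the one at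
  \<open>(p i, p j)\<close>; injectivity of \<open>p\<close> keeps the zeros off the diagonal.
\<close>

lemma similar_diagonal_mat_if_diagonal_permuted:
  fixes A B :: "'a::semiring_1 mat"
  assumes A: "A \<in> carrier_mat n n" "diagonal_mat A"
    and B: "B \<in> carrier_mat n n" "diagonal_mat B"
    and p: "p permutes {..<n}"
    and entries: "\<And>i. i < n \<Longrightarrow> A $$ (i, i) = B $$ (p i, p i)"
  shows "similar_mat A B"
proof (rule similar_matI)
  let ?P = "permutation_mat n p :: 'a mat" and ?Q = "permutation_mat n (inv_into UNIV p) :: 'a mat"
  show "{A, B, ?P, ?Q} \<subseteq> carrier_mat n n" using A B by simp
  show "?P * ?Q = 1\<^sub>m n" using p by (rule permutation_mat_mult_inv)
  show "?Q * ?P = 1\<^sub>m n"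
    using permutation_mat_mult_inv[OF permutes_inv[OF p]] by (simp add: permutes_inv_inv[OF p])
  show "A = ?P * B * ?Q"
  proof (rule eq_matI)
    fix i j assume "i < dim_row (?P * B * ?Q)" "j < dim_col (?P * B * ?Q)"
    then have ij: "i < n" "j < n" by (simp_all add: permutation_mat_def)
    then have pij: "p i < n" "p j < n"
      using permutes_in_image[OF p] by auto
    have "(?P * B * ?Q) $$ (i, j) = B $$ (p i, p j)"
      using ij pij B p by (simp add: mult_permutation_mat_inv_entry[where n = n]
          permutation_mat_mult_entry[where n = n] mult_carrier_mat[where n = n])
    also have "\<dots> = A $$ (i, j)"
    proof (cases "i = j")
      case True
      then show ?thesis using ij entries by simp
    next
      case False
      then have "p i \<noteq> p j" using permutes_inj[OF p] by (simp add: inj_eq)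
      then show ?thesis using False ij pij A B by (simp add: diagonal_mat_def)
    qed
    finally show "A $$ (i, j) = (?P * B * ?Q) $$ (i, j)" by simp
  qed (use A in \<open>simp_all add: permutation_mat_def\<close>)
qed

section \<open>Conjugacy up to scaling\<close>

theorem lemma3p3:
  fixes m :: nat and A1 A2 :: "complex mat"
  assumes "A1 \<in> carrier_mat m m" and "A2 \<in> carrier_mat m m"
    and "diagonal_mat A1" and "diagonal_mat A2"
    and "A1 \<noteq> 0\<^sub>m m m" and "A2 \<noteq> 0\<^sub>m m m"
    and "mat_trace A1 \<noteq> 0"
    and "\<forall>e\<in>{1..m}. mat_trace (A1 ^\<^sub>m e) * mat_trace A2 ^ e
           = mat_trace A1 ^ e * mat_trace (A2 ^\<^sub>m e)"
  shows "\<exists>t::complex. t \<noteq> 0 \<and> similar_mat A1 (t \<cdot>\<^sub>m A2)"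
proof -
  let ?diag = "\<lambda>f. image_mset f (mset_set {..<m}) :: complex multiset"
  let ?a = "\<lambda>i. A1 $$ (i, i)" and ?b = "\<lambda>i. A2 $$ (i, i)"
  have power_sum: "(\<Sum>x\<in>#?diag f. x ^ e) = (\<Sum>i<m. f i ^ e)" for f e
    by (simp add: image_mset.compositionality comp_def flip: sum_unfold_sum_mset)
  have traces: "(\<Sum>i<m. ?a i ^ e) * mat_trace A2 ^ e = mat_trace A1 ^ e * (\<Sum>i<m. ?b i ^ e)"
    if "e \<in> {1..m}" for e
    using assms(8) that mat_trace_diagonal_mat_pow[OF assms(1,3)]
      mat_trace_diagonal_mat_pow[OF assms(2,4)] by metis
  have tr2: "mat_trace A2 \<noteq> 0"
  proof
    assume "mat_trace A2 = 0"
    then have "(\<Sum>i<m. ?b i ^ e) = 0" if "e \<in> {1..m}" for e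
      using traces[OF that] that assms(7) by (auto simp: power_0_left)
    \<comment> \<open>The diagonal of \<open>A2\<close> has the same power sums as \<open>m\<close> copies of 0.\<close>
    then have "?diag ?b = ?diag (\<lambda>i. 0)"
      by (intro mset_eq_if_power_sums_eq) (auto simp only: power_sum, simp_all)
    then have "set_mset (?diag ?b) \<subseteq> {0}" by auto
    then have "?b i = 0" if "i < m" for i
      using that by auto
    then have "A2 $$ (i, j) = 0" if "i < m" "j < m" for i j
      using assms(2,4) that by (cases "i = j") (simp_all add: diagonal_mat_def)
    then have "A2 = 0\<^sub>m m m"
      using assms(2) by (intro eq_matI) simp_all
    with assms(6) show False by contradiction
  qed
  define t where "t = mat_trace A1 / mat_trace A2"
  have "t \<noteq> 0" using tr2 assms(7) by (simp add: t_def)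
  have "(\<Sum>i<m. ?a i ^ e) = (\<Sum>i<m. (t * ?b i) ^ e)" if "e \<in> {1..m}" for e
  proof -
    have "(\<Sum>i<m. ?a i ^ e) = t ^ e * (\<Sum>i<m. ?b i ^ e)"
      using traces[OF that] tr2 by (simp add: t_def power_divide field_simps)
    then show ?thesis by (simp add: power_mult_distrib sum_distrib_left)
  qed
  then have "?diag ?a = ?diag (\<lambda>i. t * ?b i)"
    by (intro mset_eq_if_power_sums_eq) (simp_all only: power_sum, simp_all)
  then obtain p where p: "p permutes {..<m}" "\<forall>i\<in>{..<m}. ?a i = t * ?b (p i)"
    using image_mset_eq_implies_permutes[of "{..<m}" ?a "\<lambda>i. t * ?b i"] by auto
  have "similar_mat A1 (t \<cdot>\<^sub>m A2)"
  proof (rule similar_diagonal_mat_if_diagonal_permuted[OF assms(1,3) _ _ p(1)])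
    fix i assume "i < m"
    then show "A1 $$ (i, i) = (t \<cdot>\<^sub>m A2) $$ (p i, p i)"
      using p assms(2) permutes_in_image[OF p(1), of i] by simp
  qed (use assms(2,4) in \<open>auto simp: diagonal_mat_def\<close>)
  with \<open>t \<noteq> 0\<close> show ?thesis by blast
qed

end
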